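(* Let $Q\subset V$ be a polyhedron. The collection $\{\mathbf 1_{C+v}: C+v\in\mathrm{tran}(\Sigma_Q^\vee)\}$ is a basis of the $\mathbb Z$-module $\mathbb I(\mathrm{Def}^+(Q))$.
   Context: $V$ is a finite-dimensional real vector space. $\mathbf 1_P$ is the indicator function of $P$; for a family $\mathscr P$ of polyhedra, $\mathbb I(\mathscr P)\subseteq\mathbb Z^V$ is the $\mathbb Z$-span of $\{\mathbf 1_P:P\in\mathscr P\}$. For a polyhedron $Q$, $\Sigma_Q$ is its outer normal fan; for a face $F$, $\sigma_F$ is the normal cone of linear functionals maximized on $Q$ exactly at $F$, and the tangent cone is $C_F=\sigma_F^\vee=\mathrm{Cone}(v'-v\mid v\in F,v'\in Q)$. $\Sigma_Q^\vee=\{C_F: F\text{ a face of }Q\}$ and $\mathrm{tran}(\Sigma_Q^\vee)=\{C+v: C\in\Sigma_Q^\vee, v\in V\}$. $\mathrm{Def}^+(Q)$ is the set of polyhedra $P$ such that each cone of $\Sigma_P$ is a union of cones of $\Sigma_Q$ (extended deformations of $Q$). *)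

theory Defs
  imports "HOL-Analysis.Analysis"
begin

text \<open>Linear functionals on V are represented via the inner product u \<bullet> x.\<close>

definition normal_cone :: "'a::euclidean_space set \<Rightarrow> 'a set \<Rightarrow> 'a set" where
  "normal_cone Q F = {u. {x \<in> Q. \<forall>y\<in>Q. u \<bullet> y \<le> u \<bullet> x} = F}"

definition normal_fan :: "'a::euclidean_space set \<Rightarrow> 'a set set" where
  "normal_fan Q = {normal_cone Q F | F. F face_of Q \<and> F \<noteq> {}}"

definition tangent_cone :: "'a::euclidean_space set \<Rightarrow> 'a set \<Rightarrow> 'a set" where
  "tangent_cone Q F = convex_cone hull {v' - v | v v'. v \<in> F \<and> v' \<in> Q}"

definition dual_fan :: "'a::euclidean_space set \<Rightarrow> 'a set set" where
  "dual_fan Q = {tangent_cone Q F | F. F face_of Q \<and> F \<noteq> {}}"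

definition tran :: "'a::euclidean_space set set \<Rightarrow> 'a set set" where
  "tran \<C> = {(\<lambda>x. x + v) ` C | C v. C \<in> \<C>}"

definition ext_deformations :: "'a::euclidean_space set \<Rightarrow> 'a set set" where
  "ext_deformations Q = {P. polyhedron P \<and>
      (\<forall>\<sigma>\<in>normal_fan P. \<exists>\<S>. \<S> \<subseteq> normal_fan Q \<and> \<sigma> = \<Union>\<S>)}"

definition ind :: "'a set \<Rightarrow> 'a \<Rightarrow> int" where
  "ind P = (\<lambda>x. if x \<in> P then 1 else 0)"

definition zspan :: "('a \<Rightarrow> int) set \<Rightarrow> ('a \<Rightarrow> int) set" where
  "zspan B = {f. \<exists>S c. finite S \<and> S \<subseteq> B \<and> f = (\<lambda>x. \<Sum>g\<in>S. c g * g x)}"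

definition z_independent :: "('a \<Rightarrow> int) set \<Rightarrow> bool" where
  "z_independent B \<longleftrightarrow> (\<forall>S c. finite S \<and> S \<subseteq> B \<and> (\<lambda>x. \<Sum>g\<in>S. c g * g x) = (\<lambda>x. 0)
      \<longrightarrow> (\<forall>g\<in>S. c g = 0))"

definition is_zbasis :: "('a \<Rightarrow> int) set \<Rightarrow> ('a \<Rightarrow> int) set \<Rightarrow> bool" where
  "is_zbasis B M \<longleftrightarrow> B \<subseteq> M \<and> zspan B = M \<and> z_independent B"

definition II :: "'a set set \<Rightarrow> ('a \<Rightarrow> int) set" where
  "II \<P> = zspan (ind ` \<P>)"

end

theory Submission
  imports Defs
begin

text \<open>Everything rests on the linearity of the Euler characteristic on closed convex sets: an
  integer relation between their indicators stays valid when every indicator of a nonempty set is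
  replaced by 1.

  Independence: let \<open>F\<close> be minimal among the faces occurring in a relation between translated
  tangent cones, and \<open>u\<close> a generic element of its relatively open normal cone. Slicing by the
  hyperplanes \<open>u \<bullet> x = t\<close> turns the relation into one between the intervals of values of \<open>u\<close>;
  comparing the two sides of one value isolates a single coefficient.

  Generation: for a deformation \<open>P\<close>, let \<open>T\<close> consist of the faces \<open>G\<close> of \<open>Q\<close> whose normal cones
  make up the support of the fan of \<open>P\<close>. Moebius inversion gives integers \<open>a G\<close> such that the
  combination of the indicators of the closed normal cones is the indicator of that support. Every
  \<open>G\<close> in \<open>T\<close> has a translate \<open>K G\<close> of its tangent cone with the same support numbers as \<open>P\<close> on the
  normal cone of \<open>G\<close>. A point \<open>x\<close> lies outside \<open>K G\<close> iff the closed normal cone of \<open>G\<close> meets the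
  convex set \<open>E\<close> of functionals strictly separating \<open>x\<close> from \<open>P\<close> with margin 1, so the Euler
  relation on \<open>E\<close> yields that the indicator of \<open>P\<close> is the sum of \<open>a G\<close> times that of \<open>K G\<close>.\<close>

subsection \<open>Euler characteristic of closed convex sets\<close>

text \<open>Subtracting the relation at a nearby \<open>t > s\<close> from the one at
  \<open>s\<close> isolates the sets ending at \<open>s\<close>: by closedness a set missing
  \<open>s\<close> also misses \<open>t\<close>, by convexity a set reaching past \<open>s\<close>
  contains \<open>t\<close>. Finiteness of \<open>I\<close> gives one \<open>t\<close> for all
  sets.\<close>

lemma sum_at_right_endpoints_eq_0:
  fixes J :: "'i \<Rightarrow> real set" and c :: "'i \<Rightarrow> int"
  assumes fin: "finite I"
    and J: "\<And>i. i \<in> I \<Longrightarrow> closed (J i)" "\<And>i. i \<in> I \<Longrightarrow> convex (J i)"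
    and zero: "\<And>t. (\<Sum>i\<in>I. c i * (if t \<in> J i then 1 else 0)) = 0"
  shows "(\<Sum>i\<in>I. c i * (if s \<in> J i \<and> (\<forall>t\<in>J i. t \<le> s) then 1 else 0)) = 0"
proof -
  let ?top = "\<lambda>i. s \<in> J i \<and> (\<forall>t\<in>J i. t \<le> s)"
  let ?P = "\<lambda>i t. (if s \<in> J i then 1 else 0) - (if t \<in> J i then 1 else 0) = (if ?top i then 1 else (0::int))"
  have "eventually (?P i) (at_right s)" if i: "i \<in> I" for i
  proof -
    consider "s \<notin> J i" | "?top i" | r where "s \<in> J i" "r \<in> J i" "s < r"
      by force
    then show ?thesis
    proof cases
      case 1
      have "open (- J i)"
        using J(1)[OF i] by (simp add: open_Compl)
      with 1 have "eventually (\<lambda>t. t \<in> - J i) (at s)"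
        by (meson ComplI eventually_at_topological)
      then have "eventually (\<lambda>t. t \<in> - J i) (at_right s)"
        by (simp add: eventually_at_split)
      then show ?thesis
        by (rule eventually_mono) (use 1 in auto)
    next
      case 2
      have "eventually (\<lambda>t. t > s) (at_right s)"
        by (simp add: eventually_at_right_less)
      then show ?thesis
        by (rule eventually_mono) (use 2 in force)
    next
      case 3
      have "eventually (\<lambda>t. t \<in> {s<..<r}) (at_right s)"
        using 3 by (rule_tac eventually_at_right_real)
      then show ?thesis
      proof (rule eventually_mono)
        fix t assume "t \<in> {s<..<r}"
        moreover have "is_interval (J i)"
          using J(2)[OF i] by (simp only: is_interval_convex_1)
        ultimately have "t \<in> J i"
          using 3(1,2) by (rule_tac mem_is_interval_1_I[of "J i" s r]) auto
        then show "?P i t"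
          using 3 by force
      qed
    qed
  qed
  then have "eventually (\<lambda>t. \<forall>i\<in>I. ?P i t) (at_right s)"
    using fin by (simp add: eventually_ball_finite)
  then have "\<exists>t. \<forall>i\<in>I. ?P i t"
    by (rule eventually_happens'[rotated]) simp
  then obtain t where t: "\<And>i. i \<in> I \<Longrightarrow> ?P i t"
    by blast
  have "(\<Sum>i\<in>I. c i * (if ?top i then 1 else 0)) =
        (\<Sum>i\<in>I. c i * ((if s \<in> J i then 1 else 0) - (if t \<in> J i then 1 else 0)))"
    by (intro sum.cong refl) (simp only: t)
  also have "\<dots> = 0"
    by (simp only: right_diff_distrib sum_subtractf zero)
  finally show ?thesis .
qed

text \<open>A nonempty compact interval has exactly one right endpoint, its \<open>Sup\<close>, so
  summing the endpoint relations over all endpoints counts every nonempty interval once.\<close>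

lemma euler_relation_real:
  fixes J :: "'i \<Rightarrow> real set" and c :: "'i \<Rightarrow> int"
  assumes fin: "finite I"
    and J: "\<And>i. i \<in> I \<Longrightarrow> compact (J i)" "\<And>i. i \<in> I \<Longrightarrow> convex (J i)"
    and zero: "\<And>t. (\<Sum>i\<in>I. c i * (if t \<in> J i then 1 else 0)) = 0"
  shows "(\<Sum>i\<in>I. c i * (if J i \<noteq> {} then 1 else 0)) = 0"
proof -
  let ?I = "{i \<in> I. J i \<noteq> {}}"
  have top: "s \<in> J i \<and> (\<forall>t\<in>J i. t \<le> s) \<longleftrightarrow> J i \<noteq> {} \<and> Sup (J i) = s" if "i \<in> I" for i s
  proof
    assume "J i \<noteq> {} \<and> Sup (J i) = s"
    then show "s \<in> J i \<and> (\<forall>t\<in>J i. t \<le> s)"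
      using J(1)[OF that] by (metis bounded_imp_bdd_above closed_contains_Sup compact_eq_bounded_closed cSup_upper)
  next
    assume "s \<in> J i \<and> (\<forall>t\<in>J i. t \<le> s)"
    then show "J i \<noteq> {} \<and> Sup (J i) = s"
      using cSup_eq_maximum by blast
  qed
  have "(\<Sum>i | i \<in> ?I \<and> Sup (J i) = s. c i) = 0" for s
  proof -
    have "(\<Sum>i | i \<in> ?I \<and> Sup (J i) = s. c i) =
        (\<Sum>i\<in>I. c i * (if J i \<noteq> {} \<and> Sup (J i) = s then 1 else 0))"
      by (rule sum.mono_neutral_cong_left) (use fin in auto)
    also have "\<dots> = (\<Sum>i\<in>I. c i * (if s \<in> J i \<and> (\<forall>t\<in>J i. t \<le> s) then 1 else 0))"
      by (intro sum.cong refl) (simp only: top)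
    also have "\<dots> = 0"
      using sum_at_right_endpoints_eq_0[of I J c s] assms compact_imp_closed by blast
    finally show ?thesis .
  qed
  then have "(\<Sum>i\<in>?I. c i) = 0"
    using sum.image_gen[of ?I c "\<lambda>i. Sup (J i)"] fin by simp
  moreover have "(\<Sum>i\<in>?I. c i) = (\<Sum>i\<in>I. c i * (if J i \<noteq> {} then 1 else 0))"
    by (rule sum.mono_neutral_cong_left) (use fin in auto)
  ultimately show ?thesis by simp
qed

text \<open>\<open>T\<close> lists the coordinates in which the sets may vary; the others are frozen
  at those of \<open>p\<close>. Freezing one more coordinate gives a relation between slices, which
  says that the projections to that coordinate satisfy a relation on the real line.\<close>

lemma euler_relation_compact:
  fixes A :: "'i \<Rightarrow> 'a::euclidean_space set" and c :: "'i \<Rightarrow> int"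
  assumes "finite T" "T \<subseteq> Basis" and fin: "finite I"
    and "\<And>i. i \<in> I \<Longrightarrow> compact (A i)" "\<And>i. i \<in> I \<Longrightarrow> convex (A i)"
    and "\<And>i x b. i \<in> I \<Longrightarrow> x \<in> A i \<Longrightarrow> b \<in> Basis - T \<Longrightarrow> x \<bullet> b = p \<bullet> b"
    and "\<And>x. (\<Sum>i\<in>I. c i * (if x \<in> A i then 1 else 0)) = 0"
  shows "(\<Sum>i\<in>I. c i * (if A i \<noteq> {} then 1 else 0)) = 0"
  using assms(1,2,4-)
proof (induction T arbitrary: A p rule: finite_induct)
  case empty
  \<comment> \<open>Without free coordinates each set is empty or \<open>{p}\<close>, so the
    hypothesis at \<open>p\<close> is the claim.\<close>
  have "A i \<subseteq> {p}" if "i \<in> I" for i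
    using empty(4)[OF that] by (auto intro: euclidean_eqI)
  then have "A i \<noteq> {} \<longleftrightarrow> p \<in> A i" if "i \<in> I" for i
    using that by blast
  then show ?case
    using empty(5)[of p] by (simp cong: sum.cong)
next
  case (insert b T)
  define J where "J = (\<lambda>i. (\<lambda>x. x \<bullet> b) ` A i)"
  have slice: "(\<Sum>i\<in>I. c i * (if A i \<inter> {x. x \<bullet> b = t} \<noteq> {} then 1 else 0)) = 0" for t
  proof (rule insert.IH[where p = "p + (t - p \<bullet> b) *\<^sub>R b"])
    show "compact (A i \<inter> {x. x \<bullet> b = t})" if "i \<in> I" for i
      using insert.prems(2)[OF that] closed_hyperplane[of b t] by (simp add: compact_Int_closed inner_commute)
    show "convex (A i \<inter> {x. x \<bullet> b = t})" if "i \<in> I" for i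
      using insert.prems(3)[OF that] convex_hyperplane[of b t] by (simp add: convex_Int inner_commute)
    show "x \<bullet> b' = (p + (t - p \<bullet> b) *\<^sub>R b) \<bullet> b'"
      if "i \<in> I" "x \<in> A i \<inter> {x. x \<bullet> b = t}" "b' \<in> Basis - T" for i x b'
    proof (cases "b' = b")
      case True
      then show ?thesis using that insert.prems(1) by (simp add: inner_add_left)
    next
      case False
      then show ?thesis using that insert.prems(1) insert.prems(4)[of i x b']
        by (simp add: inner_add_left inner_Basis)
    qed
    show "(\<Sum>i\<in>I. c i * (if x \<in> A i \<inter> {x. x \<bullet> b = t} then 1 else 0)) = 0" for x
      using insert.prems(5)[of x] by (cases "x \<bullet> b = t") auto
  qed (use insert.prems in auto)
  have "(\<Sum>i\<in>I. c i * (if t \<in> J i then 1 else 0)) = 0" for t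
  proof -
    have "t \<in> J i \<longleftrightarrow> A i \<inter> {x. x \<bullet> b = t} \<noteq> {}" for i
      by (auto simp: J_def)
    then show ?thesis using slice[of t] by simp
  qed
  moreover have "compact (J i)" "convex (J i)" if "i \<in> I" for i
    unfolding J_def using insert.prems(2,3)[OF that]
    by (simp_all add: compact_continuous_image continuous_on_inner continuous_on_id continuous_on_const
        convex_linear_image bounded_linear.linear bounded_linear_inner_left)
  ultimately have "(\<Sum>i\<in>I. c i * (if J i \<noteq> {} then 1 else 0)) = 0"
    using fin by (intro euler_relation_real)
  then show ?case
    by (simp add: J_def)
qed

text \<open>Intersecting with a ball that contains a chosen point of every nonempty set makes all
  sets compact and empties none of them.\<close>

lemma euler_relation:
  fixes A :: "'i \<Rightarrow> 'a::euclidean_space set" and c :: "'i \<Rightarrow> int"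
  assumes fin: "finite I"
    and A: "\<And>i. i \<in> I \<Longrightarrow> closed (A i)" "\<And>i. i \<in> I \<Longrightarrow> convex (A i)"
    and zero: "\<And>x. (\<Sum>i\<in>I. c i * (if x \<in> A i then 1 else 0)) = 0"
  shows "(\<Sum>i\<in>I. c i * (if A i \<noteq> {} then 1 else 0)) = 0"
proof -
  obtain p where p: "\<And>i. A i \<noteq> {} \<Longrightarrow> p i \<in> A i"
    using that[of "\<lambda>i. SOME x. x \<in> A i"] by (simp add: some_in_eq)
  obtain r where r: "p ` I \<subseteq> cball 0 r"
    using fin by (meson bounded_subset_ballD ball_subset_cball subset_trans finite_imp_bounded finite_imageI)
  have ne: "A i \<inter> cball 0 r \<noteq> {} \<longleftrightarrow> A i \<noteq> {}" if "i \<in> I" for i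
    using p[of i] r that by blast
  have "(\<Sum>i\<in>I. c i * (if A i \<inter> cball 0 r \<noteq> {} then 1 else 0)) = 0"
  proof (rule euler_relation_compact[where T = Basis and p = 0])
    show "(\<Sum>i\<in>I. c i * (if x \<in> A i \<inter> cball 0 r then 1 else 0)) = 0" for x
      using zero[of x] by (cases "x \<in> cball 0 r") auto
  qed (use fin A in \<open>auto simp: closed_Int_compact convex_Int\<close>)
  then show ?thesis
    using ne by (simp cong: sum.cong)
qed

text \<open>This is the relation between the sets \<open>A i \<inter> E\<close> and \<open>E\<close>
  itself, which enters with coefficient -1 under the extra index \<open>None\<close>.\<close>

lemma euler_relation_partition:
  fixes A :: "'i \<Rightarrow> 'a::euclidean_space set" and c :: "'i \<Rightarrow> int"
  assumes fin: "finite I"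
    and A: "\<And>i. i \<in> I \<Longrightarrow> closed (A i)" "\<And>i. i \<in> I \<Longrightarrow> convex (A i)"
    and E: "closed E" "convex E"
    and one: "\<And>x. x \<in> E \<Longrightarrow> (\<Sum>i\<in>I. c i * (if x \<in> A i then 1 else 0)) = 1"
  shows "(\<Sum>i\<in>I. c i * (if A i \<inter> E \<noteq> {} then 1 else 0)) = (if E \<noteq> {} then 1 else 0)"
proof -
  let ?A = "\<lambda>j. case j of None \<Rightarrow> E | Some i \<Rightarrow> A i \<inter> E"
  let ?c = "\<lambda>j. case j of None \<Rightarrow> -1 | Some i \<Rightarrow> c i"
  let ?I = "insert None (Some ` I)"
  have sum: "(\<Sum>j\<in>?I. f j) = f None + (\<Sum>i\<in>I. f (Some i))" for f :: "'i option \<Rightarrow> int"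
    using fin by (subst sum.insert) (auto simp: sum.reindex)
  have "(\<Sum>j\<in>?I. ?c j * (if ?A j \<noteq> {} then 1 else 0)) = 0"
  proof (rule euler_relation)
    show "(\<Sum>j\<in>?I. ?c j * (if x \<in> ?A j then 1 else 0)) = 0" for x
      unfolding sum using one[of x] by (cases "x \<in> E") auto
  qed (use fin A E in \<open>auto simp: closed_Int convex_Int\<close>)
  then show ?thesis
    unfolding sum by simp
qed

subsection \<open>Maxima of functionals, normal cones and tangent cones of polyhedra\<close>

lemma polyhedron_halfspaces:
  fixes P :: "'a::euclidean_space set"
  assumes "polyhedron P"
  obtains I :: "('a \<times> real) set" where "finite I" "P = {x. \<forall>i\<in>I. fst i \<bullet> x \<le> snd i}"
proof -
  obtain H where H: "finite H" "P = \<Inter>H" "\<forall>h\<in>H. \<exists>a b. a \<noteq> 0 \<and> h = {x. a \<bullet> x \<le> b}"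
    using assms by (auto simp: polyhedron_def)
  then obtain a b where ab: "\<And>h. h \<in> H \<Longrightarrow> h = {x. a h \<bullet> x \<le> b h}"
    by metis
  let ?I = "(\<lambda>h. (a h, b h)) ` H"
  have "x \<in> P \<longleftrightarrow> (\<forall>i\<in>?I. fst i \<bullet> x \<le> snd i)" for x
    using ab H(2) by fastforce
  then show ?thesis
    by (intro that[of ?I]) (use H(1) in auto)
qed

lemma polyhedron_halfspacesI:
  fixes I :: "('a::euclidean_space \<times> real) set"
  assumes "finite I"
  shows "polyhedron {x. \<forall>i\<in>I. fst i \<bullet> x \<le> snd i}"
proof -
  have "{x. \<forall>i\<in>I. fst i \<bullet> x \<le> snd i} = \<Inter>((\<lambda>i. {x. fst i \<bullet> x \<le> snd i}) ` I)"
    by auto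
  moreover have "polyhedron (\<Inter>((\<lambda>i. {x. fst i \<bullet> x \<le> snd i}) ` I))"
    using assms by (intro polyhedron_Inter) (auto simp: polyhedron_halfspace_le)
  ultimately show ?thesis
    by simp
qed

text \<open>From a feasible point one moves in a direction that increases the functional and keeps the
  active constraints active, until a further constraint becomes active; at the end the value only
  depends on the set of active constraints, so only finitely many values remain.\<close>

lemma halfspaces_improve:
  fixes I :: "('a::euclidean_space \<times> real) set" and u :: 'a
  defines "P \<equiv> {x. \<forall>i\<in>I. fst i \<bullet> x \<le> snd i}"
    and "act \<equiv> (\<lambda>x. {i \<in> I. fst i \<bullet> x = snd i})"
  assumes fin: "finite I" and x: "x \<in> P" and bdd: "\<And>y. y \<in> P \<Longrightarrow> u \<bullet> y \<le> m"
  shows "\<exists>y\<in>P. u \<bullet> x \<le> u \<bullet> y \<and> (\<forall>d. (\<forall>i\<in>act y. fst i \<bullet> d = 0) \<longrightarrow> u \<bullet> d = 0)"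
  using x
proof (induction "card (I - act x)" arbitrary: x rule: less_induct)
  case less
  show ?case
  proof (cases "\<forall>d. (\<forall>i\<in>act x. fst i \<bullet> d = 0) \<longrightarrow> u \<bullet> d = 0")
    case True
    then show ?thesis using less.prems by blast
  next
    case False
    then obtain d0 where d0: "\<forall>i\<in>act x. fst i \<bullet> d0 = 0" "u \<bullet> d0 \<noteq> 0"
      by blast
    \<comment> \<open>Scaling by \<open>u \<bullet> d0\<close> settles the sign: the value of
      \<open>u\<close> becomes a square.\<close>
    define d where "d = (u \<bullet> d0) *\<^sub>R d0"
    have d: "\<forall>i\<in>act x. fst i \<bullet> d = 0" "u \<bullet> d > 0"
      using d0 by (auto simp: d_def not_square_less_zero simp flip: power2_eq_square)
    \<comment> \<open>Only the constraints in \<open>J\<close> obstruct a move along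
      \<open>d\<close>; \<open>r i\<close> is the step length at which such an \<open>i\<close>
      becomes active.\<close>
    define J where "J = {i \<in> I. fst i \<bullet> d > 0}"
    define r where "r = (\<lambda>i. (snd i - fst i \<bullet> x) / (fst i \<bullet> d))"
    have xP: "fst i \<bullet> x \<le> snd i" if "i \<in> I" for i
      using less.prems that by (auto simp: P_def)
    have "J \<noteq> {}"
    proof
      assume "J = {}"
      \<comment> \<open>A step of this length raises \<open>u\<close> past the bound
        \<open>m\<close>.\<close>
      define t where "t = (\<bar>m\<bar> + \<bar>u \<bullet> x\<bar> + 1) / (u \<bullet> d)"
      have "t \<ge> 0"
        using d(2) by (simp add: t_def)
      have "x + t *\<^sub>R d \<in> P"
      proof -
        have "fst i \<bullet> x + t * (fst i \<bullet> d) \<le> snd i" if "i \<in> I" for i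
        proof -
          have "i \<notin> J"
            using \<open>J = {}\<close> by simp
          then have "fst i \<bullet> d \<le> 0"
            using that by (simp add: J_def)
          then have "t * (fst i \<bullet> d) \<le> 0"
            using \<open>t \<ge> 0\<close> by (simp add: mult_nonneg_nonpos)
          then show ?thesis
            using xP[OF that] by linarith
        qed
        then show ?thesis
          by (auto simp: P_def inner_add_right)
      qed
      then have "u \<bullet> x + t * (u \<bullet> d) \<le> m"
        using bdd[of "x + t *\<^sub>R d"] by (simp add: inner_add_right)
      moreover have "t * (u \<bullet> d) = \<bar>m\<bar> + \<bar>u \<bullet> x\<bar> + 1"
        using d(2) by (simp add: t_def)
      ultimately show False by linarith
    qed
    have finJ: "finite J"
      using fin by (simp add: J_def)
    then obtain j where j: "j \<in> J" "\<And>i. i \<in> J \<Longrightarrow> r j \<le> r i"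
      using arg_min_if_finite[OF finJ \<open>J \<noteq> {}\<close>, of r] by (metis not_le)
    have r0: "r j \<ge> 0"
      using j(1) xP[of j] by (auto simp: r_def J_def)
    define y where "y = x + r j *\<^sub>R d"
    have iy: "fst i \<bullet> y = fst i \<bullet> x + r j * (fst i \<bullet> d)" for i
      by (simp add: y_def inner_add_right)
    have yP: "y \<in> P"
    proof -
      have "fst i \<bullet> y \<le> snd i" if i: "i \<in> I" for i
      proof (cases "i \<in> J")
        case True
        then have "fst i \<bullet> d > 0" by (simp add: J_def)
        then have "r j * (fst i \<bullet> d) \<le> snd i - fst i \<bullet> x"
          using j(2)[OF True] by (simp add: r_def pos_le_divide_eq)
        then show ?thesis by (simp add: iy)
      next
        case False
        then have "r j * (fst i \<bullet> d) \<le> 0"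
          using i r0 by (simp add: J_def mult_nonneg_nonpos)
        then show ?thesis using xP[OF i] by (simp add: iy)
      qed
      then show ?thesis by (auto simp: P_def)
    qed
    have "act x \<subseteq> act y"
      using d(1) by (auto simp: act_def iy)
    moreover have "j \<in> act y"
      using j(1) by (auto simp: act_def iy J_def r_def)
    moreover have "j \<notin> act x"
      using j(1) d(1) by (auto simp: J_def)
    ultimately have "I - act y \<subset> I - act x"
      using j(1) by (auto simp: J_def)
    then have "card (I - act y) < card (I - act x)"
      using fin by (intro psubset_card_mono) auto
    then obtain z where "z \<in> P" "u \<bullet> y \<le> u \<bullet> z" "\<forall>d. (\<forall>i\<in>act z. fst i \<bullet> d = 0) \<longrightarrow> u \<bullet> d = 0"
      using less.hyps[OF _ yP] by blast
    moreover have "u \<bullet> x \<le> u \<bullet> y"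
      using r0 d(2) by (simp add: y_def inner_add_right)
    ultimately show ?thesis
      by (meson order_trans)
  qed
qed

text \<open>Puts a functional bounded above on \<open>P\<close> into the support of the normal fan;
  this is later applied to functionals separating a point from \<open>P\<close>.\<close>

lemma polyhedron_attains_max:
  fixes P :: "'a::euclidean_space set"
  assumes "polyhedron P" "P \<noteq> {}" and bdd: "\<And>y. y \<in> P \<Longrightarrow> u \<bullet> y \<le> m"
  shows "\<exists>x\<in>P. \<forall>y\<in>P. u \<bullet> y \<le> u \<bullet> x"
proof -
  obtain I :: "('a \<times> real) set" where fin: "finite I" and P: "P = {x. \<forall>i\<in>I. fst i \<bullet> x \<le> snd i}"
    by (rule polyhedron_halfspaces[OF assms(1)])
  define act where "act = (\<lambda>x. {i \<in> I. fst i \<bullet> x = snd i})"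
  define G where "G = {y \<in> P. \<forall>d. (\<forall>i\<in>act y. fst i \<bullet> d = 0) \<longrightarrow> u \<bullet> d = 0}"
  have G: "\<exists>y\<in>G. u \<bullet> x \<le> u \<bullet> y" if "x \<in> P" for x
    using halfspaces_improve[OF fin, of x u m] that bdd unfolding P G_def act_def by blast
  have "u \<bullet> y = u \<bullet> z" if "y \<in> G" "z \<in> G" "act y = act z" for y z
  proof -
    have "\<forall>i\<in>act y. fst i \<bullet> (y - z) = 0"
      using that(3) unfolding act_def by (smt (verit) inner_diff_right mem_Collect_eq)
    then have "u \<bullet> (y - z) = 0"
      using that(1) by (simp add: G_def)
    then show ?thesis by (simp add: inner_diff_right)
  qed
  then have "finite ((\<lambda>y. u \<bullet> y) ` G)"
  proof -
    assume val: "\<And>y z. y \<in> G \<Longrightarrow> z \<in> G \<Longrightarrow> act y = act z \<Longrightarrow> u \<bullet> y = u \<bullet> z"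
    have "finite (act ` G)"
      by (rule finite_subset[of _ "Pow I"]) (use fin in \<open>auto simp: act_def\<close>)
    moreover have "(\<lambda>y. u \<bullet> y) ` G \<subseteq> (\<lambda>A. u \<bullet> (SOME y. y \<in> G \<and> act y = A)) ` act ` G"
    proof clarify
      fix y assume y: "y \<in> G"
      let ?z = "SOME z. z \<in> G \<and> act z = act y"
      have "?z \<in> G \<and> act ?z = act y"
        by (rule someI[of _ y]) (use y in simp)
      then have "u \<bullet> y = u \<bullet> ?z"
        using val y by metis
      then show "u \<bullet> y \<in> (\<lambda>A. u \<bullet> (SOME y. y \<in> G \<and> act y = A)) ` act ` G"
        using y by blast
    qed
    ultimately show ?thesis
      using finite_subset by blast
  qed
  moreover have "G \<noteq> {}"
    using G assms(2) by blast
  ultimately have max: "Max ((\<lambda>y. u \<bullet> y) ` G) \<in> (\<lambda>y. u \<bullet> y) ` G" "\<forall>y\<in>G. u \<bullet> y \<le> Max ((\<lambda>y. u \<bullet> y) ` G)"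
    by simp_all
  then obtain x where "x \<in> G" "\<forall>y\<in>G. u \<bullet> y \<le> u \<bullet> x"
    by auto
  then show ?thesis
    using G by (metis (no_types, lifting) G_def mem_Collect_eq order_trans)
qed

text \<open>The face exposed by \<open>u\<close>, empty when \<open>u\<close> attains no maximum.
  The relatively open normal cones are the fibres of this map, so statements on fans become
  statements on when two functionals have equal \<open>maxset\<close>.\<close>

definition maxset :: "'a::euclidean_space set \<Rightarrow> 'a \<Rightarrow> 'a set" where
  "maxset Q u = {x \<in> Q. \<forall>y\<in>Q. u \<bullet> y \<le> u \<bullet> x}"

text \<open>The closure of the relatively open cone \<^const>\<open>normal_cone\<close>.\<close>

definition closed_normal_cone :: "'a::euclidean_space set \<Rightarrow> 'a set \<Rightarrow> 'a set" where
  "closed_normal_cone Q F = {u. \<forall>v\<in>F. \<forall>y\<in>Q. u \<bullet> y \<le> u \<bullet> v}"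

lemma normal_cone_eq: "normal_cone Q F = {u. maxset Q u = F}"
  by (simp add: normal_cone_def maxset_def)

text \<open>Translates closed normal cones into inclusion of faces, the order used both for the
  minimal face and for Moebius inversion.\<close>

lemma closed_normal_cone_iff: "F \<subseteq> Q \<Longrightarrow> u \<in> closed_normal_cone Q F \<longleftrightarrow> F \<subseteq> maxset Q u"
  by (auto simp: closed_normal_cone_def maxset_def)

lemma closed_closed_normal_cone: "closed (closed_normal_cone Q F)"
proof -
  have "closed_normal_cone Q F = (\<Inter>v\<in>F. \<Inter>y\<in>Q. {u. (y - v) \<bullet> u \<le> 0})"
    by (auto simp: closed_normal_cone_def inner_diff_left) (metis inner_commute)+
  moreover have "closed \<dots>"
    by (intro closed_INT ballI closed_halfspace_le)
  ultimately show ?thesis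
    by simp
qed

lemma convex_closed_normal_cone: "convex (closed_normal_cone Q F)"
proof -
  have "closed_normal_cone Q F = (\<Inter>v\<in>F. \<Inter>y\<in>Q. {u. (y - v) \<bullet> u \<le> 0})"
    by (auto simp: closed_normal_cone_def inner_diff_left) (metis inner_commute)+
  moreover have "convex \<dots>"
    by (intro convex_INT convex_halfspace_le)
  ultimately show ?thesis
    by simp
qed

lemma zero_in_closed_normal_cone: "0 \<in> closed_normal_cone Q F"
  by (simp add: closed_normal_cone_def)

lemma closed_normal_cone_scaleR:
  "u \<in> closed_normal_cone Q F \<Longrightarrow> r \<ge> 0 \<Longrightarrow> r *\<^sub>R u \<in> closed_normal_cone Q F"
  by (auto simp: closed_normal_cone_def intro: mult_left_mono)

lemma maxset_subset: "maxset Q u \<subseteq> Q"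
  by (auto simp: maxset_def)

lemma maxset_face: "convex Q \<Longrightarrow> maxset Q u face_of Q"
proof -
  assume "convex Q"
  show ?thesis
  proof (cases "maxset Q u = {}")
    case False
    then obtain x where x: "x \<in> Q" "\<And>y. y \<in> Q \<Longrightarrow> u \<bullet> y \<le> u \<bullet> x"
      by (auto simp: maxset_def)
    then have "maxset Q u = Q \<inter> {y. u \<bullet> y = u \<bullet> x}"
      by (fastforce simp: maxset_def)
    then show ?thesis
      using face_of_Int_supporting_hyperplane_le[OF \<open>convex Q\<close> x(2)] by simp
  qed simp
qed

text \<open>Faces of a polyhedron are exposed, so no cone of the normal fan is empty.\<close>

lemma face_eq_maxset:
  assumes "polyhedron Q" "F face_of Q" "F \<noteq> {}"
  obtains u where "maxset Q u = F"
proof -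
  obtain a b where ab: "Q \<subseteq> {x. a \<bullet> x \<le> b}" "F = Q \<inter> {x. a \<bullet> x = b}"
    using assms exposed_face_of_polyhedron[OF assms(1)] unfolding exposed_face_of_def by blast
  obtain v where "v \<in> F" using assms(3) by blast
  then have "maxset Q a = F"
    using ab by (fastforce simp: maxset_def)
  then show ?thesis using that by blast
qed

text \<open>On \<open>F\<close> both functionals are maximal; off \<open>F\<close> the loss in
  \<open>u0\<close> is strict and \<open>u\<close> cannot make up for it.\<close>

lemma maxset_perturb:
  assumes u: "u \<in> closed_normal_cone Q F" and F: "maxset Q u0 = F" "F \<noteq> {}" and "r > 0"
  shows "maxset Q (u0 + r *\<^sub>R u) = F"
proof -
  obtain v where v: "v \<in> F" using F(2) by blast
  have 1: "u \<bullet> y \<le> u \<bullet> x" if "x \<in> F" "y \<in> Q" for x y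
    using u that by (simp add: closed_normal_cone_def)
  have 2: "u0 \<bullet> y \<le> u0 \<bullet> x" if "x \<in> F" "y \<in> Q" for x y
    using F(1) that by (auto simp: maxset_def)
  have FQ: "F \<subseteq> Q"
    using F(1) maxset_subset by blast
  show ?thesis
  proof
    show "F \<subseteq> maxset Q (u0 + r *\<^sub>R u)"
      using 1 2 FQ \<open>r > 0\<close> by (auto simp: maxset_def inner_add_left intro!: add_mono mult_left_mono)
    show "maxset Q (u0 + r *\<^sub>R u) \<subseteq> F"
    proof
      fix x assume x: "x \<in> maxset Q (u0 + r *\<^sub>R u)"
      then have xQ: "x \<in> Q" by (simp add: maxset_def)
      have "u0 \<bullet> v + r * (u \<bullet> v) \<le> u0 \<bullet> x + r * (u \<bullet> x)"
        using x v FQ by (auto simp: maxset_def inner_add_left)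
      moreover have "r * (u \<bullet> x) \<le> r * (u \<bullet> v)"
        using 1[OF v xQ] \<open>r > 0\<close> by simp
      ultimately have "u0 \<bullet> v \<le> u0 \<bullet> x" by linarith
      then have "x \<in> maxset Q u0"
        using xQ 2[OF v] by (force simp: maxset_def)
      then show "x \<in> F" using F(1) by simp
    qed
  qed
qed

text \<open>A base point \<open>v0\<close> in the relative interior of \<open>F\<close> serves for
  all of \<open>F\<close>: the constraints active there are active on \<open>F\<close> and cut out a
  polyhedral cone \<open>K\<close> containing all generators, while every vector of \<open>K\<close>
  points from \<open>v0\<close> into \<open>Q\<close> for a short distance.\<close>

lemma tangent_cone_eq:
  fixes Q :: "'a::euclidean_space set"
  assumes "polyhedron Q" and F: "F face_of Q" "F \<noteq> {}"
  obtains v0 where "v0 \<in> F" "tangent_cone Q F = {t *\<^sub>R (y - v0) | t y. t \<ge> 0 \<and> y \<in> Q}"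
    "polyhedron (tangent_cone Q F)"
proof -
  obtain I :: "('a \<times> real) set" where fin: "finite I"
    and Q: "Q = {x. \<forall>i\<in>I. fst i \<bullet> x \<le> snd i}"
    by (rule polyhedron_halfspaces[OF assms(1)])
  have FQ: "F \<subseteq> Q" using F(1) by (rule face_of_imp_subset)
  have "convex F" using F(1) by (rule face_of_imp_convex)
  then obtain v0 where v0: "v0 \<in> rel_interior F"
    using rel_interior_eq_empty F(2) by blast
  then have v0F: "v0 \<in> F" using rel_interior_subset by blast
  define I0 where "I0 = {i \<in> I. fst i \<bullet> v0 = snd i}"
  define K where "K = {x. \<forall>i\<in>(\<lambda>i. (fst i, 0::real)) ` I0. fst i \<bullet> x \<le> snd i}"
  have K: "x \<in> K \<longleftrightarrow> (\<forall>i\<in>I0. fst i \<bullet> x \<le> 0)" for x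
    by (simp add: K_def)
  let ?R = "{t *\<^sub>R (y - v0) | t y. t \<ge> 0 \<and> y \<in> Q}"
  have polyK: "polyhedron K"
    unfolding K_def using fin by (intro polyhedron_halfspacesI) (simp add: I0_def)
  have active: "fst i \<bullet> v = snd i" if i: "i \<in> I0" and v: "v \<in> F" for i v
  proof -
    \<comment> \<open>The segment from \<open>v\<close> to \<open>v0\<close> can be prolonged beyond
      \<open>v0\<close> inside \<open>F\<close>; slack at \<open>v\<close> would become a violation
      at the new point.\<close>
    obtain e where e: "e > 1" "(1 - e) *\<^sub>R v + e *\<^sub>R v0 \<in> F"
      using bspec[OF convex_rel_interior_if2[OF \<open>convex F\<close> v0] hull_inc[OF v]] by blast
    have "fst i \<bullet> ((1 - e) *\<^sub>R v + e *\<^sub>R v0) \<le> snd i"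
      using e(2) FQ i by (auto simp: Q I0_def)
    then have "(1 - e) * (fst i \<bullet> v) + e * snd i \<le> snd i"
      using i by (simp add: inner_add_right I0_def)
    then have "(e - 1) * (snd i - fst i \<bullet> v) \<le> 0"
      by (simp add: algebra_simps)
    then have "snd i \<le> fst i \<bullet> v"
      using e(1) by (simp add: mult_le_0_iff)
    moreover have "fst i \<bullet> v \<le> snd i"
      using v FQ i by (auto simp: Q I0_def)
    ultimately show ?thesis by simp
  qed
  have 1: "tangent_cone Q F \<subseteq> K"
    unfolding tangent_cone_def
  proof (rule hull_minimal)
    show "{v' - v |v v'. v \<in> F \<and> v' \<in> Q} \<subseteq> K"
      using active by (auto simp: K inner_diff_right I0_def Q)
    have "K = \<Inter>((\<lambda>i. {x. fst i \<bullet> x \<le> 0}) ` I0)"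
      using K by auto
    then show "convex_cone K"
      by (auto intro: convex_cone_Inter convex_cone_halfspace_le)
  qed
  have 2: "K \<subseteq> ?R"
  proof
    fix x assume x: "x \<in> K"
    \<comment> \<open>Active constraints do not increase along \<open>x\<close>; the slack of the
      others survives small steps by continuity.\<close>
    have "eventually (\<lambda>e. fst i \<bullet> (v0 + e *\<^sub>R x) \<le> snd i) (at_right 0)" if i: "i \<in> I" for i
    proof (cases "i \<in> I0")
      case True
      then have "fst i \<bullet> x \<le> 0" using x K by blast
      have "eventually (\<lambda>e. e > 0) (at_right (0::real))"
        by (simp add: eventually_at_right_less)
      then show ?thesis
        by (rule eventually_mono)
          (use True \<open>fst i \<bullet> x \<le> 0\<close> in \<open>auto simp: inner_add_right I0_def mult_nonneg_nonpos\<close>)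
    next
      case False
      then have "fst i \<bullet> v0 < snd i"
        using i v0F FQ by (force simp: I0_def Q)
      moreover have "((\<lambda>e. fst i \<bullet> (v0 + e *\<^sub>R x)) \<longlongrightarrow> fst i \<bullet> (v0 + 0 *\<^sub>R x)) (at_right 0)"
        by (intro tendsto_intros)
      ultimately have "eventually (\<lambda>e. fst i \<bullet> (v0 + e *\<^sub>R x) < snd i) (at_right 0)"
        by (intro order_tendstoD(2)) auto
      then show ?thesis by (rule eventually_mono) simp
    qed
    then have "eventually (\<lambda>e. \<forall>i\<in>I. fst i \<bullet> (v0 + e *\<^sub>R x) \<le> snd i) (at_right 0)"
      using fin by (simp add: eventually_ball_finite)
    then have "eventually (\<lambda>e. e > 0 \<and> (\<forall>i\<in>I. fst i \<bullet> (v0 + e *\<^sub>R x) \<le> snd i)) (at_right 0)"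
      by (intro eventually_conj) (simp add: eventually_at_right_less)
    then have "\<exists>e. e > 0 \<and> (\<forall>i\<in>I. fst i \<bullet> (v0 + e *\<^sub>R x) \<le> snd i)"
      by (rule eventually_happens'[rotated]) simp
    then obtain e where e: "e > 0" "v0 + e *\<^sub>R x \<in> Q"
      by (auto simp: Q)
    have "x = (1 / e) *\<^sub>R ((v0 + e *\<^sub>R x) - v0)"
      using e(1) by simp
    then show "x \<in> ?R"
      using e by (metis (mono_tags, lifting) divide_nonneg_pos mem_Collect_eq zero_le_one)
  qed
  have 3: "?R \<subseteq> tangent_cone Q F"
  proof clarify
    fix t y assume "t \<ge> (0::real)" "y \<in> Q"
    then have "y - v0 \<in> tangent_cone Q F"
      unfolding tangent_cone_def using v0F by (intro hull_inc) blast
    then show "t *\<^sub>R (y - v0) \<in> tangent_cone Q F"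
      unfolding tangent_cone_def using \<open>t \<ge> 0\<close> by (rule_tac convex_cone_hull_mul)
  qed
  have "tangent_cone Q F = ?R" "tangent_cone Q F = K"
    using 1 2 3 by blast+
  then show ?thesis
    using polyK by (intro that[OF v0F]) simp_all
qed

text \<open>The closed normal cone is the polar of the tangent cone: it suffices to test generators,
  since a halfspace bounded by a hyperplane through 0 is a convex cone.\<close>

lemma le_0_on_tangent_cone_iff:
  "(\<forall>x\<in>tangent_cone Q F. u \<bullet> x \<le> 0) \<longleftrightarrow> u \<in> closed_normal_cone Q F"
proof
  assume "\<forall>x\<in>tangent_cone Q F. u \<bullet> x \<le> 0"
  moreover have "y - v \<in> tangent_cone Q F" if "v \<in> F" "y \<in> Q" for v y
    unfolding tangent_cone_def using that by (intro hull_inc) blast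
  ultimately show "u \<in> closed_normal_cone Q F"
    by (force simp: closed_normal_cone_def inner_diff_right)
next
  assume u: "u \<in> closed_normal_cone Q F"
  have "tangent_cone Q F \<subseteq> {x. u \<bullet> x \<le> 0}"
    unfolding tangent_cone_def
    by (rule hull_minimal) (use u in \<open>auto simp: convex_cone_halfspace_le closed_normal_cone_def inner_diff_right\<close>)
  then show "\<forall>x\<in>tangent_cone Q F. u \<bullet> x \<le> 0" by blast
qed

lemma convex_cone_tangent_cone: "convex_cone (tangent_cone Q F)"
  by (simp add: tangent_cone_def convex_cone_convex_cone_hull)

text \<open>The bipolar theorem; the tangent cone is closed because it is polyhedral, so a point
  outside it can be strictly separated.\<close>

lemma tangent_cone_bidual:
  assumes "polyhedron Q" "F face_of Q" "F \<noteq> {}"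
  shows "x \<in> tangent_cone Q F \<longleftrightarrow> (\<forall>u\<in>closed_normal_cone Q F. u \<bullet> x \<le> 0)"
proof
  assume "x \<in> tangent_cone Q F"
  then show "\<forall>u\<in>closed_normal_cone Q F. u \<bullet> x \<le> 0"
    using le_0_on_tangent_cone_iff by blast
next
  assume le: "\<forall>u\<in>closed_normal_cone Q F. u \<bullet> x \<le> 0"
  let ?C = "tangent_cone Q F"
  have cc: "convex_cone ?C" by (rule convex_cone_tangent_cone)
  show "x \<in> ?C"
  proof (rule ccontr)
    assume "x \<notin> ?C"
    moreover have "polyhedron ?C"
      by (rule tangent_cone_eq[OF assms])
    then have "convex ?C" "closed ?C"
      by (simp_all add: polyhedron_imp_convex polyhedron_imp_closed)
    ultimately obtain a b where ab: "a \<bullet> x < b" "\<And>y. y \<in> ?C \<Longrightarrow> b < a \<bullet> y"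
      using separating_hyperplane_closed_point[of ?C x] by auto
    have "b < 0"
      using ab(2)[of 0] convex_cone_contains_0[OF cc] by simp
    have "(- a) \<bullet> y \<le> 0" if y: "y \<in> ?C" for y
    proof (rule ccontr)
      assume "\<not> (- a) \<bullet> y \<le> 0"
      then have ay: "a \<bullet> y < 0" by simp
      \<comment> \<open>The factor is nonnegative, and the rescaled point has value exactly
        \<open>b\<close>, against strict separation.\<close>
      then have "(b / (a \<bullet> y)) *\<^sub>R y \<in> ?C"
        using y \<open>b < 0\<close> by (intro convex_cone_scaleR[OF cc]) (auto simp: divide_nonpos_neg)
      then have "b < (b / (a \<bullet> y)) * (a \<bullet> y)"
        using ab(2) by fastforce
      then show False using ay by simp
    qed
    then have "- a \<in> closed_normal_cone Q F"
      using le_0_on_tangent_cone_iff by blast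
    then have "(- a) \<bullet> x \<le> 0"
      using le by blast
    then show False
      using ab(1) \<open>b < 0\<close> by simp
  qed
qed

subsection \<open>Linear independence\<close>

text \<open>Such a cone is \<open>{0}\<close>, a closed ray or the whole line. This supplies the
  closedness of the value sets of a functional on a tangent cone, which closedness of the cone alone
  would not give.\<close>

lemma closed_conic_real:
  fixes L :: "real set"
  assumes "conic L" "0 \<in> L"
  shows "closed L"
proof -
  define A where "A = (if \<exists>x\<in>L. x > 0 then {0..} else {0::real})"
  define B where "B = (if \<exists>x\<in>L. x < 0 then {..0} else {0::real})"
  have scale: "y \<in> L" if "x \<in> L" "x \<noteq> 0" "y / x \<ge> 0" for x y
    using conic_mul[OF assms(1) that(1,3)] that(2) by simp
  have "A \<subseteq> L" "B \<subseteq> L"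
    using scale assms(2) by (auto simp: A_def B_def divide_nonpos_neg)
  moreover have "x \<in> A \<union> B" if "x \<in> L" for x
    using that by (cases x "0::real" rule: linorder_cases) (auto simp: A_def B_def)
  ultimately have "L = A \<union> B"
    by blast
  moreover have "closed A" "closed B"
    by (auto simp: A_def B_def)
  ultimately show ?thesis
    by (simp add: closed_Un)
qed

text \<open>Each \<open>w\<close> excludes only a proper part of the normal cone, so small
  corrections by closed-cone vectors avoid all of them; \<open>maxset_perturb\<close> keeps the
  exposed face.\<close>

lemma generic_normal_vector:
  assumes "finite W" "polyhedron Q" and F: "F face_of Q" "F \<noteq> {}"
    and "\<And>w. w \<in> W \<Longrightarrow> \<exists>u\<in>closed_normal_cone Q F. u \<bullet> w \<noteq> 0"
  shows "\<exists>u. maxset Q u = F \<and> (\<forall>w\<in>W. u \<bullet> w \<noteq> 0)"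
  using assms(1,5)
proof (induction W rule: finite_induct)
  case empty
  then show ?case
    using face_eq_maxset[OF assms(2) F] by auto
next
  case (insert w W)
  then obtain u where u: "maxset Q u = F" "\<forall>w\<in>W. u \<bullet> w \<noteq> 0"
    by auto
  obtain d where d: "d \<in> closed_normal_cone Q F" "d \<bullet> w \<noteq> 0"
    using insert.prems by auto
  show ?case
  proof (cases "u \<bullet> w = 0")
    case False
    then show ?thesis using u by blast
  next
    case True
    \<comment> \<open>These are the lengths at which some \<open>w\<close> in \<open>W\<close> could
      be lost. Where \<open>d \<bullet> w = 0\<close> the quotient is 0, which \<open>r > 0\<close>
      avoids anyway.\<close>
    have "finite ((\<lambda>w. - (u \<bullet> w) / (d \<bullet> w)) ` W)"
      using insert.hyps by simp
    then obtain r :: real where r: "r > 0" "r \<notin> (\<lambda>w. - (u \<bullet> w) / (d \<bullet> w)) ` W"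
      using infinite_Ioi[of "0::real"] by (metis greaterThan_iff rev_finite_subset subsetI)
    have "maxset Q (u + r *\<^sub>R d) = F"
      using maxset_perturb[OF d(1) u(1) F(2) r(1)] .
    moreover have "(u + r *\<^sub>R d) \<bullet> w' \<noteq> 0" if "w' \<in> W" for w'
    proof
      assume 0: "(u + r *\<^sub>R d) \<bullet> w' = 0"
      then have "d \<bullet> w' \<noteq> 0"
        using u(2) that by (auto simp: inner_add_left)
      moreover have "r * (d \<bullet> w') = - (u \<bullet> w')"
        using 0 by (simp add: inner_add_left)
      ultimately have "r = - (u \<bullet> w') / (d \<bullet> w')"
        by (metis nonzero_mult_div_cancel_right)
      then show False using r(2) that by blast
    qed
    moreover have "(u + r *\<^sub>R d) \<bullet> w \<noteq> 0"
      using True d(2) r(1) by (simp add: inner_add_left)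
    ultimately show ?thesis by blast
  qed
qed

text \<open>Translation along the lineality space fixes the cone. Hence translation vectors are not
  unique, and distinct translates differ by a vector outside that space.\<close>

lemma convex_cone_translate_eq:
  assumes "convex_cone C" "w \<in> C" "- w \<in> C"
  shows "(\<lambda>x. x + (v + w)) ` C = (\<lambda>x. x + v) ` C"
proof
  show "(\<lambda>x. x + (v + w)) ` C \<subseteq> (\<lambda>x. x + v) ` C"
  proof clarify
    fix x assume "x \<in> C"
    then have "x + w \<in> C" using assms by (simp add: convex_cone_add)
    then show "x + (v + w) \<in> (\<lambda>x. x + v) ` C"
      by (rule rev_image_eqI) (simp add: algebra_simps)
  qed
  show "(\<lambda>x. x + v) ` C \<subseteq> (\<lambda>x. x + (v + w)) ` C"
  proof clarify
    fix x assume "x \<in> C"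
    then have "x + - w \<in> C" using assms by (intro convex_cone_add)
    then show "x + v \<in> (\<lambda>x. x + (v + w)) ` C"
      by (rule rev_image_eqI) (simp add: algebra_simps)
  qed
qed

text \<open>Adding a vector of the cone to a maximizer cannot increase \<open>u\<close>, so
  \<open>u\<close> is nonpositive on the cone and its maximum is reached at the apex.\<close>

lemma functional_max_translated_cone:
  assumes C: "convex_cone C" and s: "s \<in> (\<lambda>x. u \<bullet> x) ` (\<lambda>x. x + v) ` C"
    "\<forall>t\<in>(\<lambda>x. u \<bullet> x) ` (\<lambda>x. x + v) ` C. t \<le> s"
  shows "s = u \<bullet> v" "\<forall>x\<in>C. u \<bullet> x \<le> 0"
proof -
  obtain x where x: "x \<in> C" "s = u \<bullet> x + u \<bullet> v"
    using s(1) by (auto simp: inner_add_right)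
  have le: "u \<bullet> y \<le> u \<bullet> x" if "y \<in> C" for y
    using s(2) that x(2) by (simp add: inner_add_right)
  show neg: "\<forall>y\<in>C. u \<bullet> y \<le> 0"
    using le[OF convex_cone_add[OF C x(1)]] by (simp add: inner_add_right)
  have "u \<bullet> x = 0"
    using neg x(1) le[OF convex_cone_contains_0[OF C]] by force
  then show "s = u \<bullet> v"
    using x(2) by simp
qed

lemma z_independent_tran_dual_fan:
  fixes Q :: "'a::euclidean_space set"
  assumes Q: "polyhedron Q"
  shows "z_independent (ind ` tran (dual_fan Q))"
  unfolding z_independent_def
proof (intro allI impI, elim conjE)
  fix S :: "('a \<Rightarrow> int) set" and c
  assume finS: "finite S" and SB: "S \<subseteq> ind ` tran (dual_fan Q)"
    and zero: "(\<lambda>x. \<Sum>g\<in>S. c g * g x) = (\<lambda>x. 0)"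
  have "\<forall>g\<in>S. \<exists>F v. F face_of Q \<and> F \<noteq> {} \<and> g = ind ((\<lambda>x. x + v) ` tangent_cone Q F)"
    using SB unfolding tran_def dual_fan_def by blast
  then obtain F v where F: "\<And>g. g \<in> S \<Longrightarrow> F g face_of Q" "\<And>g. g \<in> S \<Longrightarrow> F g \<noteq> {}"
    and g: "\<And>g. g \<in> S \<Longrightarrow> g = ind ((\<lambda>x. x + v g) ` tangent_cone Q (F g))"
    unfolding bchoice_iff by blast
  define K where "K = (\<lambda>g. (\<lambda>x. x + v g) ` tangent_cone Q (F g))"
  define S' where "S' = {g \<in> S. c g \<noteq> 0}"
  have S': "finite S'" "S' \<subseteq> S"
    using finS by (auto simp: S'_def)
  have gx: "g x = (if x \<in> K g then 1 else 0)" if "g \<in> S" for g x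
    by (subst g[OF that]) (simp add: ind_def K_def)
  have zero': "(\<Sum>g\<in>S'. c g * (if x \<in> K g then 1 else 0)) = 0" for x
  proof -
    have "(\<Sum>g\<in>S'. c g * (if x \<in> K g then 1 else 0)) = (\<Sum>g\<in>S. c g * g x)"
      by (rule sum.mono_neutral_cong_left) (use finS gx in \<open>auto simp: S'_def\<close>)
    also have "\<dots> = 0" using zero by metis
    finally show ?thesis .
  qed
  have "S' = {}"
  proof (rule ccontr)
    assume "S' \<noteq> {}"
    \<comment> \<open>The faces whose closed normal cones contain a \<open>u\<close> exposing
      \<open>F0\<close> are those inside \<open>F0\<close>; by minimality only \<open>F0\<close>
      itself occurs among them.\<close>
    then obtain F0 where "F0 \<in> F ` S'" and min: "\<And>G. G \<in> F ` S' \<Longrightarrow> G \<subseteq> F0 \<Longrightarrow> G = F0"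
      using finite_has_minimal[of "F ` S'"] S'(1) by (metis finite_imageI image_is_empty)
    then obtain g0 where g0: "g0 \<in> S'" "F0 = F g0"
      by blast
    have F0: "F0 face_of Q" "F0 \<noteq> {}"
      using g0 F S'(2) by blast+
    let ?C = "tangent_cone Q F0"
    \<comment> \<open>If \<open>u\<close> vanishes on no vector of \<open>W\<close>, the other
      translates of the same cone have their maxima at values different from
      \<open>u \<bullet> v g0\<close>.\<close>
    define W where "W = {v g - v g0 | g. g \<in> S' \<and> F g = F0 \<and> g \<noteq> g0}"
    have "finite W"
      unfolding W_def using S'(1) by (rule_tac finite_subset[of _ "(\<lambda>g. v g - v g0) ` S'"]) auto
    \<comment> \<open>Otherwise \<open>w\<close> and \<open>- w\<close> both lie in the tangent cone
      by biduality, and the two translates would coincide.\<close>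
    moreover have "\<exists>u\<in>closed_normal_cone Q F0. u \<bullet> w \<noteq> 0" if w: "w \<in> W" for w
    proof (rule ccontr)
      assume neg: "\<not> (\<exists>u\<in>closed_normal_cone Q F0. u \<bullet> w \<noteq> 0)"
      obtain g1 where g1: "g1 \<in> S'" "F g1 = F0" "g1 \<noteq> g0" "w = v g1 - v g0"
        using w unfolding W_def by blast
      have "w \<in> ?C" "- w \<in> ?C"
        using neg unfolding tangent_cone_bidual[OF Q F0] by auto
      then have "(\<lambda>x. x + (v g0 + w)) ` ?C = (\<lambda>x. x + v g0) ` ?C"
        by (rule convex_cone_translate_eq[OF convex_cone_tangent_cone])
      then have "K g1 = K g0"
        using g0(2) g1(2,4) by (simp add: K_def)
      then have "g1 = g0"
        using gx g1(1) g0(1) S'(2) by (intro ext) (metis subsetD)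
      then show False using g1(3) by blast
    qed
    ultimately obtain u where u: "maxset Q u = F0" "\<forall>w\<in>W. u \<bullet> w \<noteq> 0"
      using generic_normal_vector[OF _ Q F0] by blast
    define J where "J = (\<lambda>g. (\<lambda>x. u \<bullet> x) ` K g)"
    let ?s = "u \<bullet> v g0"
    have polyK: "convex (K g)" "closed (K g)" if "g \<in> S'" for g
    proof -
      have "polyhedron (tangent_cone Q (F g))"
        using tangent_cone_eq[OF Q] F S'(2) that by (metis subsetD)
      then show "convex (K g)" "closed (K g)"
        unfolding K_def
        by (simp_all add: polyhedron_imp_convex polyhedron_imp_closed closed_translation
            convex_translation add.commute[of _ "v g"])
    qed
    have J0: "(\<Sum>g\<in>S'. c g * (if t \<in> J g then 1 else 0)) = 0" for t
    proof -
      have "(\<Sum>g\<in>S'. c g * (if K g \<inter> {x. u \<bullet> x = t} \<noteq> {} then 1 else 0)) = 0"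
      proof (rule euler_relation[OF S'(1)])
        show "(\<Sum>g\<in>S'. c g * (if x \<in> K g \<inter> {x. u \<bullet> x = t} then 1 else 0)) = 0" for x
          using zero'[of x] by (cases "u \<bullet> x = t") auto
      qed (use polyK in \<open>auto simp: closed_Int closed_hyperplane convex_Int convex_hyperplane\<close>)
      moreover have "K g \<inter> {x. u \<bullet> x = t} \<noteq> {} \<longleftrightarrow> t \<in> J g" for g
        by (auto simp: J_def)
      ultimately show ?thesis by simp
    qed
    have "(\<Sum>g\<in>S'. c g * (if ?s \<in> J g \<and> (\<forall>t\<in>J g. t \<le> ?s) then 1 else 0)) = 0"
    proof (rule sum_at_right_endpoints_eq_0[OF S'(1) _ _ J0])
      fix g assume "g \<in> S'"
      then show "convex (J g)"
        unfolding J_def using polyK(1)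
        by (simp add: convex_linear_image bounded_linear.linear bounded_linear_inner_right)
      let ?L = "(\<lambda>x. u \<bullet> x) ` tangent_cone Q (F g)"
      have "conic (tangent_cone Q (F g))"
        by (simp add: tangent_cone_def conic_convex_cone_hull)
      then have "conic ?L"
        by (rule conic_linear_image) (simp add: bounded_linear.linear bounded_linear_inner_right)
      moreover have "0 \<in> ?L"
        using convex_cone_contains_0[OF convex_cone_tangent_cone] by (metis imageI inner_zero_right)
      ultimately have "closed ((+) (u \<bullet> v g) ` ?L)"
        by (intro closed_translation closed_conic_real)
      moreover have "J g = (+) (u \<bullet> v g) ` ?L"
        by (simp add: J_def K_def image_image inner_add_right add.commute)
      ultimately show "closed (J g)"
        by simp
    qed
    moreover have "?s \<in> J g \<and> (\<forall>t\<in>J g. t \<le> ?s) \<longleftrightarrow> g = g0" if gS: "g \<in> S'" for g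
    proof
      assume s: "?s \<in> J g \<and> (\<forall>t\<in>J g. t \<le> ?s)"
      have max: "?s = u \<bullet> v g" "\<forall>x\<in>tangent_cone Q (F g). u \<bullet> x \<le> 0"
        using functional_max_translated_cone[OF convex_cone_tangent_cone, of ?s u "v g" Q "F g"] s
        unfolding J_def K_def by blast+
      then have "u \<in> closed_normal_cone Q (F g)"
        using le_0_on_tangent_cone_iff by blast
      moreover have "F g \<subseteq> Q"
        using F(1) gS S'(2) face_of_imp_subset by blast
      ultimately have "F g \<subseteq> F0"
        using closed_normal_cone_iff u(1) by blast
      then have "F g = F0"
        using min gS by blast
      then show "g = g0"
        using u(2) max(1) gS by (force simp: W_def inner_diff_right)
    next
      assume "g = g0"
      have N: "u \<in> closed_normal_cone Q F0"
        using u(1) by (simp add: closed_normal_cone_iff face_of_imp_subset[OF F0(1)])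
      have "0 \<in> ?C"
        by (rule convex_cone_contains_0[OF convex_cone_tangent_cone])
      then have "?s \<in> J g0"
        unfolding J_def K_def g0(2) by (force simp: image_image)
      moreover have "\<forall>t\<in>J g0. t \<le> ?s"
        using N le_0_on_tangent_cone_iff[of Q F0 u] by (auto simp: J_def K_def g0(2) inner_add_right)
      ultimately show "?s \<in> J g \<and> (\<forall>t\<in>J g. t \<le> ?s)"
        using \<open>g = g0\<close> by blast
    qed
    ultimately have "(\<Sum>g\<in>S'. c g * (if g = g0 then 1 else 0)) = 0"
      by (simp cong: sum.cong)
    moreover have "(\<Sum>g\<in>S'. c g * (if g = g0 then 1 else 0)) = c g0"
      using S'(1) g0(1) by (simp add: if_distrib[of "(*) _"] cong: if_cong)
    ultimately show False
      using g0(1) by (simp add: S'_def)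
  qed
  then show "\<forall>g\<in>S. c g = 0"
    by (auto simp: S'_def)
qed

subsection \<open>Generation\<close>

text \<open>\<open>zspan\<close> indexes coefficients by the functions themselves, so the
  coefficients of repeated members of the family are first added up over the fibres of
  \<open>f\<close>.\<close>

lemma sum_in_zspan:
  assumes "finite I" and B: "\<And>i. i \<in> I \<Longrightarrow> f i \<in> B"
  shows "(\<lambda>x. \<Sum>i\<in>I. c i * f i x) \<in> zspan B"
proof -
  define d where "d = (\<lambda>g. \<Sum>i | i \<in> I \<and> f i = g. c i)"
  have "(\<Sum>i\<in>I. c i * f i x) = (\<Sum>g\<in>f ` I. d g * g x)" for x
  proof -
    have "(\<Sum>i\<in>I. c i * f i x) = (\<Sum>g\<in>f ` I. \<Sum>i | i \<in> I \<and> f i = g. c i * f i x)"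
      using sum.image_gen[OF \<open>finite I\<close>] by blast
    also have "\<dots> = (\<Sum>g\<in>f ` I. d g * g x)"
      unfolding d_def sum_distrib_right by (intro sum.cong) auto
    finally show ?thesis .
  qed
  then show ?thesis
    unfolding zspan_def using assms by (auto intro!: exI[of _ "f ` I"] exI[of _ d])
qed

lemma zspan_mono: "B \<subseteq> B' \<Longrightarrow> zspan B \<subseteq> zspan B'"
  unfolding zspan_def by blast

lemma zspan_base: "g \<in> B \<Longrightarrow> g \<in> zspan B"
  using sum_in_zspan[of "{()}" "\<lambda>_. g" B "\<lambda>_. 1"] by simp

lemma zspan_subset:
  assumes "B \<subseteq> zspan B'"
  shows "zspan B \<subseteq> zspan B'"
proof
  fix f assume "f \<in> zspan B"
  then obtain S c where S: "finite S" "S \<subseteq> B" and f: "f = (\<lambda>x. \<Sum>g\<in>S. c g * g x)"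
    by (auto simp: zspan_def)
  have "\<forall>g\<in>S. \<exists>T d. finite T \<and> T \<subseteq> B' \<and> g = (\<lambda>x. \<Sum>h\<in>T. d h * h x)"
  proof
    fix g assume "g \<in> S"
    then have "g \<in> zspan B'"
      using S(2) assms by blast
    then show "\<exists>T d. finite T \<and> T \<subseteq> B' \<and> g = (\<lambda>x. \<Sum>h\<in>T. d h * h x)"
      by (simp only: zspan_def mem_Collect_eq)
  qed
  then obtain T d where T: "\<And>g. g \<in> S \<Longrightarrow> finite (T g)" "\<And>g. g \<in> S \<Longrightarrow> T g \<subseteq> B'"
    and g: "\<And>g. g \<in> S \<Longrightarrow> g = (\<lambda>x. \<Sum>h\<in>T g. d g h * h x)"
    unfolding bchoice_iff by blast
  have "f x = (\<Sum>p\<in>Sigma S T. (c (fst p) * d (fst p) (snd p)) * snd p x)" for x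
  proof -
    have "f x = (\<Sum>g\<in>S. \<Sum>h\<in>T g. (c g * d g h) * h x)"
      unfolding f
    proof (rule sum.cong)
      fix g assume "g \<in> S"
      have "g x = (\<Sum>h\<in>T g. d g h * h x)"
        by (subst g[OF \<open>g \<in> S\<close>]) (rule refl)
      then show "c g * g x = (\<Sum>h\<in>T g. (c g * d g h) * h x)"
        by (simp add: sum_distrib_left mult.assoc)
    qed simp
    also have "\<dots> = (\<Sum>p\<in>Sigma S T. (c (fst p) * d (fst p) (snd p)) * snd p x)"
      using S(1) T(1) by (simp add: sum.Sigma split_beta)
    finally show ?thesis .
  qed
  moreover have "(\<lambda>x. \<Sum>p\<in>Sigma S T. (c (fst p) * d (fst p) (snd p)) * snd p x) \<in> zspan B'"
    by (rule sum_in_zspan) (use S(1) T in \<open>auto simp: subset_iff\<close>)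
  ultimately show "f \<in> zspan B'"
    by presburger
qed

text \<open>The system is triangular: a maximal \<open>M\<close> occurs in no other equation, so its
  coefficient can be chosen last to satisfy its own.\<close>

lemma ex_moebius_coefficients:
  assumes "finite T"
  shows "\<exists>a :: 'b set \<Rightarrow> int. \<forall>G\<in>T. (\<Sum>H | H \<in> T \<and> H \<subseteq> G. a H) = 1"
  using assms
proof (induction "card T" arbitrary: T)
  case 0
  then show ?case by simp
next
  case (Suc n)
  then obtain M where M: "M \<in> T" "\<And>H. H \<in> T \<Longrightarrow> M \<subseteq> H \<Longrightarrow> H = M"
    using finite_has_maximal[of T] by (metis card.empty nat.simps(3))
  have "n = card (T - {M})" "finite (T - {M})"
    using M(1) Suc.hyps(2) Suc.prems by (simp_all add: card_Diff_singleton)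
  then obtain a :: "'b set \<Rightarrow> int" where a: "\<forall>G\<in>T - {M}. (\<Sum>H | H \<in> T - {M} \<and> H \<subseteq> G. a H) = 1"
    using Suc.hyps(1) by blast
  define a' where "a' = a(M := 1 - (\<Sum>H | H \<in> T - {M} \<and> H \<subseteq> M. a H))"
  have eq: "(\<Sum>H | H \<in> T - {M} \<and> H \<subseteq> G. a' H) = (\<Sum>H | H \<in> T - {M} \<and> H \<subseteq> G. a H)" for G
    by (intro sum.cong) (auto simp: a'_def)
  have "(\<Sum>H | H \<in> T \<and> H \<subseteq> G. a' H) = 1" if "G \<in> T" for G
  proof (cases "G = M")
    case True
    then have "{H. H \<in> T \<and> H \<subseteq> G} = insert M {H. H \<in> T - {M} \<and> H \<subseteq> M}"
      using M(1) by blast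
    then have "(\<Sum>H | H \<in> T \<and> H \<subseteq> G. a' H) = a' M + (\<Sum>H | H \<in> T - {M} \<and> H \<subseteq> M. a' H)"
      using Suc.prems by simp
    then show ?thesis
      unfolding eq by (simp add: a'_def)
  next
    case False
    then have "{H. H \<in> T \<and> H \<subseteq> G} = {H. H \<in> T - {M} \<and> H \<subseteq> G}"
      using M(2) that by blast
    then show ?thesis
      using eq a False that by simp
  qed
  then show ?case by blast
qed

text \<open>The cones of the fan of \<open>Q\<close> are the nonempty-face fibres of
  \<open>maxset Q\<close>; a set is a union of them iff it lies in their union and contains every
  fibre it meets.\<close>

lemma ext_deformations_iff:
  assumes "polyhedron P" "polyhedron Q"
  shows "P \<in> ext_deformations Q \<longleftrightarrow>
    (\<forall>u. maxset P u \<noteq> {} \<longrightarrow> maxset Q u \<noteq> {} \<and> (\<forall>w. maxset Q w = maxset Q u \<longrightarrow> maxset P w = maxset P u))"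
    (is "_ \<longleftrightarrow> ?R")
proof
  assume P: "P \<in> ext_deformations Q"
  show ?R
  proof (intro allI impI)
    fix u assume ne: "maxset P u \<noteq> {}"
    then have "normal_cone P (maxset P u) \<in> normal_fan P"
      using maxset_face[OF polyhedron_imp_convex[OF assms(1)]] by (auto simp: normal_fan_def)
    then obtain S where S: "S \<subseteq> normal_fan Q" "normal_cone P (maxset P u) = \<Union>S"
      using P by (auto simp: ext_deformations_def)
    have "u \<in> normal_cone P (maxset P u)"
      by (simp add: normal_cone_eq)
    then obtain \<sigma> where \<sigma>: "u \<in> \<sigma>" "\<sigma> \<in> S"
      using S(2) by blast
    then obtain F where F: "\<sigma> = normal_cone Q F" "F \<noteq> {}"
      using S(1) by (auto simp: normal_fan_def)
    then have Fu: "maxset Q u = F"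
      using \<sigma>(1) by (simp add: normal_cone_eq)
    have "maxset P w = maxset P u" if "maxset Q w = maxset Q u" for w
    proof -
      have "w \<in> normal_cone P (maxset P u)"
        using that Fu F(1) \<sigma>(2) S(2) by (auto simp: normal_cone_eq)
      then show ?thesis by (simp add: normal_cone_eq)
    qed
    then show "maxset Q u \<noteq> {} \<and> (\<forall>w. maxset Q w = maxset Q u \<longrightarrow> maxset P w = maxset P u)"
      using Fu F(2) by blast
  qed
next
  assume R: ?R
  have "\<exists>S\<subseteq>normal_fan Q. \<sigma> = \<Union>S" if "\<sigma> \<in> normal_fan P" for \<sigma>
  proof -
    obtain F where F: "\<sigma> = normal_cone P F" "F \<noteq> {}"
      using \<open>\<sigma> \<in> normal_fan P\<close> by (auto simp: normal_fan_def)
    let ?S = "(\<lambda>u. normal_cone Q (maxset Q u)) ` \<sigma>"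
    have "?S \<subseteq> normal_fan Q"
    proof clarify
      fix u assume "u \<in> \<sigma>"
      then have "maxset Q u \<noteq> {}"
        using R F by (simp add: normal_cone_eq)
      then show "normal_cone Q (maxset Q u) \<in> normal_fan Q"
        using maxset_face[OF polyhedron_imp_convex[OF assms(2)]] by (auto simp: normal_fan_def)
    qed
    moreover have "\<sigma> = \<Union>?S"
      using R F by (auto simp: normal_cone_eq)
    ultimately show ?thesis by blast
  qed
  then show "P \<in> ext_deformations Q"
    using assms(1) by (simp add: ext_deformations_def)
qed

lemma maxset_translation: "maxset ((\<lambda>x. x + v) ` C) u = (\<lambda>x. x + v) ` maxset C u"
  by (auto simp: maxset_def inner_add_right)

lemma polyhedron_translation:
  fixes C :: "'a::euclidean_space set"
  assumes "polyhedron C"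
  shows "polyhedron ((\<lambda>x. x + v) ` C)"
proof -
  obtain I :: "('a \<times> real) set" where I: "finite I" "C = {x. \<forall>i\<in>I. fst i \<bullet> x \<le> snd i}"
    by (rule polyhedron_halfspaces[OF assms])
  let ?I = "(\<lambda>i. (fst i, snd i + fst i \<bullet> v)) ` I"
  have "(\<lambda>x. x + v) ` C = {x. \<forall>i\<in>?I. fst i \<bullet> x \<le> snd i}"
  proof
    show "{x. \<forall>i\<in>?I. fst i \<bullet> x \<le> snd i} \<subseteq> (\<lambda>x. x + v) ` C"
    proof
      fix x assume x: "x \<in> {x. \<forall>i\<in>?I. fst i \<bullet> x \<le> snd i}"
      then have "\<forall>i\<in>I. fst i \<bullet> (x - v) \<le> snd i"
        by (force simp: inner_diff_right)
      then have "x - v \<in> C"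
        by (simp add: I(2))
      then show "x \<in> (\<lambda>x. x + v) ` C"
        by (metis diff_add_cancel imageI)
    qed
  qed (auto simp: I(2) inner_add_right)
  then show ?thesis
    using polyhedron_halfspacesI[of ?I] I(1) by simp
qed

text \<open>A functional with a maximum on the tangent cone lies in the closed normal cone of
  \<open>F\<close>, and the face it exposes is the cone from \<open>v0\<close> over
  \<open>maxset Q u\<close>, hence depends only on that set.\<close>

lemma tran_dual_fan_subset_ext_deformations:
  fixes Q :: "'a::euclidean_space set"
  assumes "polyhedron Q"
  shows "tran (dual_fan Q) \<subseteq> ext_deformations Q"
proof
  fix K assume "K \<in> tran (dual_fan Q)"
  then obtain F v where F: "F face_of Q" "F \<noteq> {}" and K: "K = (\<lambda>x. x + v) ` tangent_cone Q F"
    by (auto simp: tran_def dual_fan_def)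
  let ?C = "tangent_cone Q F"
  obtain v0 where v0: "v0 \<in> F" and C: "?C = {t *\<^sub>R (y - v0) | t y. t \<ge> 0 \<and> y \<in> Q}" and poly: "polyhedron ?C"
    by (rule tangent_cone_eq[OF assms F])
  have cc: "convex_cone ?C" by (rule convex_cone_tangent_cone)
  have FQ: "F \<subseteq> Q" using F(1) by (rule face_of_imp_subset)
  have N: "u \<in> closed_normal_cone Q F" if ne: "maxset ?C u \<noteq> {}" for u
  proof -
    obtain x where x: "x \<in> ?C" "\<And>y. y \<in> ?C \<Longrightarrow> u \<bullet> y \<le> u \<bullet> x"
      using ne by (auto simp: maxset_def)
    have "u \<bullet> y \<le> 0" if "y \<in> ?C" for y
      using x(2)[OF convex_cone_add[OF cc x(1) that]] by (simp add: inner_add_right)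
    then show ?thesis
      using le_0_on_tangent_cone_iff by blast
  qed
  \<comment> \<open>The disjunct \<open>t = 0\<close> admits the apex, which has representations
    with any \<open>y\<close> in \<open>Q\<close>.\<close>
  have max: "maxset ?C u = {t *\<^sub>R (y - v0) | t y. t \<ge> 0 \<and> y \<in> Q \<and> (t = 0 \<or> y \<in> maxset Q u)}"
    if u: "u \<in> closed_normal_cone Q F" for u
  proof -
    have 0: "0 \<in> ?C" using cc by (rule convex_cone_contains_0)
    have le: "u \<bullet> x \<le> 0" if "x \<in> ?C" for x
      using u le_0_on_tangent_cone_iff that by blast
    have v0u: "v0 \<in> maxset Q u"
      using u closed_normal_cone_iff[OF FQ] v0 by blast
    have max0: "x \<in> maxset ?C u \<longleftrightarrow> x \<in> ?C \<and> u \<bullet> x = 0" for x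
      using 0 le by (force simp: maxset_def)
    have eq0: "u \<bullet> (t *\<^sub>R (y - v0)) = 0 \<longleftrightarrow> t = 0 \<or> y \<in> maxset Q u" if "y \<in> Q" for t y
    proof -
      have "u \<bullet> (y - v0) = 0 \<longleftrightarrow> y \<in> maxset Q u"
        using v0u that by (auto simp: maxset_def inner_diff_right intro: antisym)
      then show ?thesis by simp
    qed
    show ?thesis
    proof (intro set_eqI iffI)
      fix x assume x: "x \<in> maxset ?C u"
      then have "x \<in> ?C"
        using max0 by blast
      then obtain t y where ty: "x = t *\<^sub>R (y - v0)" "t \<ge> 0" "y \<in> Q"
        unfolding C by blast
      then have "t = 0 \<or> y \<in> maxset Q u"
        using max0 x eq0 by blast
      then show "x \<in> {t *\<^sub>R (y - v0) | t y. t \<ge> 0 \<and> y \<in> Q \<and> (t = 0 \<or> y \<in> maxset Q u)}"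
        using ty by blast
    next
      fix x assume "x \<in> {t *\<^sub>R (y - v0) | t y. t \<ge> 0 \<and> y \<in> Q \<and> (t = 0 \<or> y \<in> maxset Q u)}"
      then obtain t y where ty: "x = t *\<^sub>R (y - v0)" "t \<ge> 0" "y \<in> Q" "t = 0 \<or> y \<in> maxset Q u"
        by blast
      then have "x \<in> ?C" "u \<bullet> x = 0"
        using eq0 unfolding C by blast+
      then show "x \<in> maxset ?C u"
        using max0 by blast
    qed
  qed
  have "K \<in> ext_deformations Q"
    unfolding K ext_deformations_iff[OF polyhedron_translation[OF poly] assms] maxset_translation
  proof (intro allI impI conjI)
    fix u assume "(\<lambda>x. x + v) ` maxset ?C u \<noteq> {}"
    then have u: "u \<in> closed_normal_cone Q F"
      using N by blast
    then show "maxset Q u \<noteq> {}"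
      using closed_normal_cone_iff[OF FQ] v0 by blast
    fix w assume w: "maxset Q w = maxset Q u"
    then have "w \<in> closed_normal_cone Q F"
      using u closed_normal_cone_iff[OF FQ] by simp
    then show "(\<lambda>x. x + v) ` maxset ?C w = (\<lambda>x. x + v) ` maxset ?C u"
      using max u w by simp
  qed
  then show "K \<in> ext_deformations Q" .
qed

text \<open>Perturbing \<open>u0\<close> by large multiples of \<open>u\<close> keeps its face of
  \<open>Q\<close>, hence of \<open>P\<close>. Rescaled, these functionals converge to
  \<open>u\<close>, and the closed normal cone of \<open>P\<close> contains the limit.\<close>

lemma ext_deformation_closed_normal_cone:
  assumes P: "polyhedron P" and Q: "polyhedron Q" and ext: "P \<in> ext_deformations Q"
    and u0: "maxset P u0 \<noteq> {}" and u: "u \<in> closed_normal_cone Q (maxset Q u0)"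
  shows "u \<in> closed_normal_cone P (maxset P u0)"
proof -
  let ?F = "maxset P u0"
  have QF: "maxset Q u0 \<noteq> {}" and same: "\<And>w. maxset Q w = maxset Q u0 \<Longrightarrow> maxset P w = ?F"
    using ext u0 unfolding ext_deformations_iff[OF P Q] by blast+
  have in_N: "u + (1 / real (Suc n)) *\<^sub>R u0 \<in> closed_normal_cone P ?F" for n
  proof -
    have "maxset P (u0 + real (Suc n) *\<^sub>R u) = ?F"
      by (rule same, rule maxset_perturb[OF u refl QF]) simp
    then have "u0 + real (Suc n) *\<^sub>R u \<in> closed_normal_cone P ?F"
      by (simp add: closed_normal_cone_iff maxset_subset)
    then have "(1 / real (Suc n)) *\<^sub>R (u0 + real (Suc n) *\<^sub>R u) \<in> closed_normal_cone P ?F"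
      by (rule closed_normal_cone_scaleR) simp
    then show ?thesis
      by (simp add: scaleR_add_right add.commute del: of_nat_Suc)
  qed
  have "(\<lambda>n. u + (1 / real (Suc n)) *\<^sub>R u0) \<longlonglongrightarrow> u + 0 *\<^sub>R u0"
    by (intro tendsto_intros LIMSEQ_Suc[OF lim_1_over_n])
  then show ?thesis
    using closed_sequentially[OF closed_closed_normal_cone[of P ?F], of "\<lambda>n. u + (1 / real (Suc n)) *\<^sub>R u0"] in_N by simp
qed

lemma ind_ext_deformation_in_zspan:
  fixes P Q :: "'a::euclidean_space set"
  assumes P: "polyhedron P" and Q: "polyhedron Q" and ext: "P \<in> ext_deformations Q"
  shows "ind P \<in> zspan (ind ` tran (dual_fan Q))"
proof (cases "P = {}")
  \<comment> \<open>The normal fan of the empty set has no cones, so it counts as a deformation; its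
    indicator is the empty combination.\<close>
  case True
  then have "ind P = (\<lambda>x. \<Sum>i\<in>({}::nat set). 0 * ind P x)"
    by (simp add: ind_def)
  also have "\<dots> \<in> zspan (ind ` tran (dual_fan Q))"
    by (rule sum_in_zspan) auto
  finally show ?thesis .
next
  case False
  let ?N = "closed_normal_cone Q"
  define T where "T = {maxset Q u | u. maxset P u \<noteq> {}}"
  have TQ: "G face_of Q" "G \<noteq> {}" "G \<subseteq> Q" if "G \<in> T" for G
    using that maxset_face[OF polyhedron_imp_convex[OF Q]] ext maxset_subset
    unfolding T_def ext_deformations_iff[OF P Q] by blast+
  have finT: "finite T"
    by (rule finite_subset[OF _ finite_polyhedron_faces[OF Q]]) (use TQ in auto)
  \<comment> \<open>Any point of the face of \<open>P\<close> exposed by \<open>u0\<close> will do: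
    all of \<open>?N G\<close> is maximal there. It becomes the apex of \<open>K G\<close>.\<close>
  have "\<forall>G\<in>T. \<exists>v. v \<in> P \<and> (\<forall>u\<in>?N G. \<forall>y\<in>P. u \<bullet> y \<le> u \<bullet> v)"
  proof
    fix G assume "G \<in> T"
    then obtain u0 where u0: "G = maxset Q u0" "maxset P u0 \<noteq> {}"
      by (auto simp: T_def)
    then obtain v where v: "v \<in> maxset P u0" by blast
    have "u \<in> closed_normal_cone P (maxset P u0)" if "u \<in> ?N G" for u
      using ext_deformation_closed_normal_cone[OF P Q ext u0(2)] that u0(1) by simp
    then show "\<exists>v. v \<in> P \<and> (\<forall>u\<in>?N G. \<forall>y\<in>P. u \<bullet> y \<le> u \<bullet> v)"
      using v maxset_subset unfolding closed_normal_cone_def by blast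
  qed
  then obtain v where v: "\<And>G. G \<in> T \<Longrightarrow> v G \<in> P"
    and vmax: "\<And>G u y. G \<in> T \<Longrightarrow> u \<in> ?N G \<Longrightarrow> y \<in> P \<Longrightarrow> u \<bullet> y \<le> u \<bullet> v G"
    by metis
  obtain a :: "'a set \<Rightarrow> int" where a: "\<And>G. G \<in> T \<Longrightarrow> (\<Sum>H | H \<in> T \<and> H \<subseteq> G. a H) = 1"
    using ex_moebius_coefficients[OF finT] by blast
  have one: "(\<Sum>G\<in>T. a G * (if u \<in> ?N G then 1 else 0)) = 1" if u: "maxset P u \<noteq> {}" for u
  proof -
    have "u \<in> ?N G \<longleftrightarrow> G \<subseteq> maxset Q u" if "G \<in> T" for G
      using TQ(3)[OF that] by (rule closed_normal_cone_iff)
    then have "(\<Sum>G\<in>T. a G * (if u \<in> ?N G then 1 else 0)) = (\<Sum>G\<in>T. if G \<subseteq> maxset Q u then a G else 0)"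
      by (intro sum.cong) auto
    also have "\<dots> = (\<Sum>G | G \<in> T \<and> G \<subseteq> maxset Q u. a G)"
      using finT by (simp add: sum.inter_filter)
    also have "\<dots> = 1"
      using u by (intro a) (auto simp: T_def)
    finally show ?thesis .
  qed
  define K where "K = (\<lambda>G. (\<lambda>x. x + v G) ` tangent_cone Q G)"
  have "ind P x = (\<Sum>G\<in>T. a G * ind (K G) x)" for x
  proof -
    \<comment> \<open>A margin of 1 in place of strict inequality makes \<open>E\<close> closed;
      scaling turns any uniform margin into 1.\<close>
    define E where "E = {u. \<forall>y\<in>P. u \<bullet> (x - y) \<ge> 1}"
    have "E = (\<Inter>y\<in>P. {u. (x - y) \<bullet> u \<ge> 1})"
      by (auto simp: E_def inner_commute)
    then have E: "closed E" "convex E"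
      by (auto intro!: closed_INT closed_halfspace_ge convex_INT convex_halfspace_ge)
    have E_ne: "E \<noteq> {} \<longleftrightarrow> x \<notin> P"
    proof
      assume "E \<noteq> {}"
      then show "x \<notin> P" by (force simp: E_def)
    next
      assume "x \<notin> P"
      then obtain w b where w: "w \<bullet> x < b" "\<And>y. y \<in> P \<Longrightarrow> b < w \<bullet> y"
        using separating_hyperplane_closed_point[of P x] polyhedron_imp_closed[OF P] polyhedron_imp_convex[OF P]
        by auto
      have "(- (1 / (b - w \<bullet> x))) *\<^sub>R w \<in> E"
      proof -
        have "1 \<le> (w \<bullet> y - w \<bullet> x) / (b - w \<bullet> x)" if "y \<in> P" for y
          using w(1) w(2)[OF that] by simp
        then show ?thesis
          by (simp add: E_def inner_diff_right flip: minus_divide_left add: diff_divide_distrib)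
      qed
      then show "E \<noteq> {}" by blast
    qed
    \<comment> \<open>This places \<open>E\<close> inside the support of the fan of
      \<open>P\<close>, where \<open>one\<close> holds.\<close>
    have E_max: "maxset P u \<noteq> {}" if "u \<in> E" for u
    proof -
      have "u \<bullet> y \<le> u \<bullet> x - 1" if "y \<in> P" for y
        using \<open>u \<in> E\<close> that by (force simp: E_def inner_diff_right)
      then show ?thesis
        using polyhedron_attains_max[OF P False, of u "u \<bullet> x - 1"] by (auto simp: maxset_def)
    qed
    \<comment> \<open>Since \<open>v G\<close> maximizes each functional of \<open>?N G\<close> over
      \<open>P\<close>, one that is positive at \<open>x - v G\<close> rescales to 1 there and then
      separates \<open>x\<close> from all of \<open>P\<close>.\<close>
    have K: "x \<in> K G \<longleftrightarrow> ?N G \<inter> E = {}" if G: "G \<in> T" for G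
    proof -
      have "x \<in> K G \<longleftrightarrow> x - v G \<in> tangent_cone Q G"
        by (auto simp: K_def image_iff) (metis diff_add_cancel)
      also have "\<dots> \<longleftrightarrow> (\<forall>u\<in>?N G. u \<bullet> (x - v G) \<le> 0)"
        using tangent_cone_bidual[OF Q] TQ[OF G] by blast
      also have "\<dots> \<longleftrightarrow> ?N G \<inter> E = {}"
      proof
        assume "\<forall>u\<in>?N G. u \<bullet> (x - v G) \<le> 0"
        then show "?N G \<inter> E = {}"
          using v[OF G] by (force simp: E_def)
      next
        assume disj: "?N G \<inter> E = {}"
        show "\<forall>u\<in>?N G. u \<bullet> (x - v G) \<le> 0"
        proof (rule ccontr)
          assume "\<not> (\<forall>u\<in>?N G. u \<bullet> (x - v G) \<le> 0)"
          then obtain u where u: "u \<in> ?N G" "u \<bullet> (x - v G) > 0"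
            by force
          let ?w = "(1 / (u \<bullet> (x - v G))) *\<^sub>R u"
          have wN: "?w \<in> ?N G"
            using u by (intro closed_normal_cone_scaleR) auto
          have "?w \<bullet> (x - v G) = 1"
            using u(2) by simp
          then have "?w \<in> E"
            using vmax[OF G wN] unfolding E_def by (force simp: inner_diff_right)
          then show False using wN disj by blast
        qed
      qed
      finally show ?thesis .
    qed
    \<comment> \<open>The zero functional lies in every closed normal cone and in the support, so
      all coefficients add up to 1; this converts the count of cones meeting \<open>E\<close> into
      that of cones missing it.\<close>
    have "maxset P 0 = P"
      by (auto simp: maxset_def)
    then have "(\<Sum>G\<in>T. a G) = 1"
      using one[of 0] False by (simp add: zero_in_closed_normal_cone)
    moreover have "(\<Sum>G\<in>T. a G * (if ?N G \<inter> E \<noteq> {} then 1 else 0)) = (if E \<noteq> {} then 1 else 0)"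
      by (rule euler_relation_partition)
        (use finT E one E_max in \<open>auto simp: closed_closed_normal_cone convex_closed_normal_cone\<close>)
    moreover have "(\<Sum>G\<in>T. a G * ind (K G) x) =
        (\<Sum>G\<in>T. a G - a G * (if ?N G \<inter> E \<noteq> {} then 1 else 0))"
      by (intro sum.cong) (auto simp: ind_def K)
    ultimately show ?thesis
      using E_ne by (simp add: sum_subtractf ind_def)
  qed
  then have "ind P = (\<lambda>x. \<Sum>G\<in>T. a G * ind (K G) x)"
    by blast
  moreover have "K G \<in> tran (dual_fan Q)" if "G \<in> T" for G
    unfolding K_def tran_def dual_fan_def using TQ[OF that] by blast
  ultimately show ?thesis
    using sum_in_zspan[OF finT, of "\<lambda>G. ind (K G)" "ind ` tran (dual_fan Q)" a] by simp
qed

theorem theorem2p5: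
  fixes Q :: "'a::euclidean_space set"
  assumes "polyhedron Q"
  shows "is_zbasis (ind ` tran (dual_fan Q)) (II (ext_deformations Q))"
proof -
  let ?B = "ind ` tran (dual_fan Q)"
  have sub: "?B \<subseteq> ind ` ext_deformations Q"
    using tran_dual_fan_subset_ext_deformations[OF assms] by blast
  have "ind P \<in> zspan ?B" if "P \<in> ext_deformations Q" for P
    using ind_ext_deformation_in_zspan[OF _ assms that] that by (simp add: ext_deformations_def)
  then have "II (ext_deformations Q) \<subseteq> zspan ?B"
    unfolding II_def by (intro zspan_subset) blast
  moreover have "zspan ?B \<subseteq> II (ext_deformations Q)"
    unfolding II_def using sub by (rule zspan_mono)
  moreover have "?B \<subseteq> II (ext_deformations Q)"
    unfolding II_def using sub zspan_base by blast
  ultimately show ?thesis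
    unfolding is_zbasis_def using z_independent_tran_dual_fan[OF assms] by blast
qed

end
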